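(* Let $\mu$ be an $r$-Carleson measure on $[0,1)$ for some $r>1$. Then: (i) $H_\mu:H^\infty\to A(\mathbb{T})$ and $C_\mu:H^\infty\to A(\mathbb{T})$ are both well defined nuclear operators; (ii) $H_\mu:H^2\to H^2$ and $C_\mu:H^2\to H^2$ are both well defined compact operators, and $H_\mu$ on $H^2$ is self-adjoint; (iii) if $r>\frac32$, then $H_\mu:H^2\to A(\mathbb{T})$ and $C_\mu:H^2\to A(\mathbb{T})$ are both well defined nuclear operators.
   Context: Functions $f(z)=\sum_{n\ge0}a_nz^n$ holomorphic on the unit disc $\mathbb{D}$ are identified with their coefficient sequences $(a_n)$. $H^\infty$ is the space of bounded holomorphic functions on $\mathbb{D}$ with the sup norm; $H^2$ is the Hardy space, identified with $\ell^2_A=\{f:\sum|a_n|^2<\infty\}$; $A(\mathbb{T})$ is the Wiener algebra, identified with $\ell^1_A=\{f:\sum|a_n|<\infty\}$. For a positive finite Borel measure $\mu$ on $[0,1)$, $\mu_n=\int_0^1t^n\,d\mu(t)$; $\mu$ is $r$-Carleson if $\mu([t,1))=O((1-t)^r)$ as $t\to1^-$. On coefficient sequences, $H_\mu((a_n))=\left(\sum_{n=0}^\infty\mu_{n+k}a_n\right)_{k\ge0}$ and $C_\mu((a_n))=\left(\mu_k\sum_{n=0}^ka_n\right)_{k\ge0}$. An operator $T:X\to Y$ is nuclear if $T=\sum_nx_n^*(\cdot)y_n$ with $x_n^*\in X^*$, $y_n\in Y$, $\sum_n\|x_n^*\|\|y_n\|<\infty$. *)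

theory Defs
  imports "HOL-Analysis.Analysis" "HOL-Library.Landau_Symbols"
begin

type_synonym cseq = "nat \<Rightarrow> complex"

section \<open>Sequence spaces (holomorphic functions identified with coefficient sequences)\<close>

definition Hinf :: "cseq set" where
  "Hinf = {a. (\<forall>z::complex. norm z < 1 \<longrightarrow> summable (\<lambda>n. a n * z ^ n)) \<and>
              bounded ((\<lambda>z. \<Sum>n. a n * z ^ n) ` ball 0 1)}"

definition Hinf_norm :: "cseq \<Rightarrow> real" where
  "Hinf_norm a = (SUP z\<in>ball (0::complex) 1. norm (\<Sum>n. a n * z ^ n))"

text \<open>H^2 identified with l^2_A.\<close>
definition H2 :: "cseq set" where
  "H2 = {a. summable (\<lambda>n. (norm (a n))\<^sup>2)}"

definition H2_norm :: "cseq \<Rightarrow> real" where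
  "H2_norm a = sqrt (\<Sum>n. (norm (a n))\<^sup>2)"

definition H2_inner :: "cseq \<Rightarrow> cseq \<Rightarrow> complex" where
  "H2_inner a b = (\<Sum>n. a n * cnj (b n))"

text \<open>Wiener algebra A(T) identified with l^1_A.\<close>
definition AT :: "cseq set" where
  "AT = {a. summable (\<lambda>n. norm (a n))}"

definition AT_norm :: "cseq \<Rightarrow> real" where
  "AT_norm a = (\<Sum>n. norm (a n))"

definition measure_on_01 :: "real measure \<Rightarrow> bool" where
  "measure_on_01 \<mu> \<longleftrightarrow> finite_measure \<mu> \<and> sets \<mu> = sets borel \<and>
      emeasure \<mu> (UNIV - {0..<1}) = 0"

definition moment :: "real measure \<Rightarrow> nat \<Rightarrow> real" where
  "moment \<mu> n = (\<integral>t. t ^ n \<partial>\<mu>)"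

definition r_Carleson :: "real \<Rightarrow> real measure \<Rightarrow> bool" where
  "r_Carleson r \<mu> \<longleftrightarrow> (\<lambda>t. measure \<mu> {t..<1}) \<in> O[at_left 1](\<lambda>t. (1 - t) powr r)"

definition Hankel :: "real measure \<Rightarrow> cseq \<Rightarrow> cseq" where
  "Hankel \<mu> a = (\<lambda>k. \<Sum>n. complex_of_real (moment \<mu> (n + k)) * a n)"

definition Cesaro :: "real measure \<Rightarrow> cseq \<Rightarrow> cseq" where
  "Cesaro \<mu> a = (\<lambda>k. complex_of_real (moment \<mu> k) * (\<Sum>n\<le>k. a n))"

definition Hankel_well_defined :: "real measure \<Rightarrow> cseq set \<Rightarrow> cseq set \<Rightarrow> bool" where
  "Hankel_well_defined \<mu> X Y \<longleftrightarrow>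
     (\<forall>a\<in>X. (\<forall>k. summable (\<lambda>n. complex_of_real (moment \<mu> (n + k)) * a n)) \<and> Hankel \<mu> a \<in> Y)"

definition Cesaro_well_defined :: "real measure \<Rightarrow> cseq set \<Rightarrow> cseq set \<Rightarrow> bool" where
  "Cesaro_well_defined \<mu> X Y \<longleftrightarrow> (\<forall>a\<in>X. Cesaro \<mu> a \<in> Y)"

definition nuclear_op ::
  "cseq set \<Rightarrow> (cseq \<Rightarrow> real) \<Rightarrow> cseq set \<Rightarrow> (cseq \<Rightarrow> real) \<Rightarrow> (cseq \<Rightarrow> cseq) \<Rightarrow> bool" where
  "nuclear_op X nX Y nY T \<longleftrightarrow>
     (\<exists>(\<phi>::nat \<Rightarrow> cseq \<Rightarrow> complex) (y::nat \<Rightarrow> cseq) (c::nat \<Rightarrow> real).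
        (\<forall>n. \<forall>a\<in>X. \<forall>b\<in>X. \<phi> n (\<lambda>k. a k + b k) = \<phi> n a + \<phi> n b) \<and>
        (\<forall>n. \<forall>a\<in>X. \<forall>s::complex. \<phi> n (\<lambda>k. s * a k) = s * \<phi> n a) \<and>
        (\<forall>n. c n \<ge> 0 \<and> (\<forall>a\<in>X. norm (\<phi> n a) \<le> c n * nX a)) \<and>
        (\<forall>n. y n \<in> Y) \<and>
        summable (\<lambda>n. c n * nY (y n)) \<and>
        (\<forall>a\<in>X. (\<lambda>N. nY (\<lambda>k. T a k - (\<Sum>n<N. \<phi> n a * y n k))) \<longlonglongrightarrow> 0))"

definition compact_op ::
  "cseq set \<Rightarrow> (cseq \<Rightarrow> real) \<Rightarrow> cseq set \<Rightarrow> (cseq \<Rightarrow> real) \<Rightarrow> (cseq \<Rightarrow> cseq) \<Rightarrow> bool" where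
  "compact_op X nX Y nY T \<longleftrightarrow>
     (\<forall>s::nat \<Rightarrow> cseq. (\<forall>j. s j \<in> X) \<and> bounded (range (\<lambda>j. nX (s j))) \<longrightarrow>
        (\<exists>\<sigma> L. strict_mono \<sigma> \<and> L \<in> Y \<and>
           (\<lambda>j. nY (\<lambda>k. T (s (\<sigma> j)) k - L k)) \<longlonglongrightarrow> 0))"

definition self_adjoint_H2 :: "(cseq \<Rightarrow> cseq) \<Rightarrow> bool" where
  "self_adjoint_H2 T \<longleftrightarrow> (\<forall>a\<in>H2. \<forall>b\<in>H2. H2_inner (T a) b = H2_inner a (T b))"

end

theory Submission
  imports Defs "HOL-Complex_Analysis.Great_Picard" "HOL-Real_Asymp.Real_Asymp"
begin

text \<open>
  An operator with coordinates \<open>\<bar>(T a)\<^sub>k\<bar> \<le> d\<^sub>k \<parallel>a\<parallel>\<close> is nuclear into \<open>\<ell>\<^sup>1\<close> if \<open>(d\<^sub>k)\<close> is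
  summable (expand along the unit vectors) and compact into \<open>\<ell>\<^sup>2\<close> if it is square summable, so
  everything reduces to bounding the coordinate functionals, given \<open>\<mu>\<^sub>n = O(n\<^bsup>-r\<^esup>)\<close>.
  On \<open>H\<^sup>\<infinity>\<close>, the Hankel coordinates are \<open>\<integral> t\<^sup>k f(t) d\<mu>(t)\<close>, so \<open>d\<^sub>k = \<mu>\<^sub>k\<close> works, and for the
  Cesaro operator Landau's bound on Taylor partial sums gives \<open>d\<^sub>k = \<mu>\<^sub>k (1 + ln (k + 1))\<close>.
  On \<open>H\<^sup>2\<close>, the Cauchy-Schwarz inequality gives \<open>d\<^sub>k = O(k\<^bsup>-p\<^esup>)\<close> for every \<open>p < r - 1/2\<close>.
\<close>

subsection \<open>Operators given by coordinate functionals\<close>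

lemma AT_of_coordinate_bound:
  assumes "\<And>k. norm (T k) \<le> d k * C" and "summable d"
  shows "T \<in> AT"
  unfolding AT_def
  using summable_comparison_test'[of "\<lambda>k. d k * C" 0 "\<lambda>k. norm (T k)"] assms
  by (simp add: summable_mult2)

lemma H2_of_coordinate_bound:
  assumes "\<And>k. norm (T k) \<le> d k * C" and "summable (\<lambda>k. (d k)\<^sup>2)"
  shows "T \<in> H2"
proof -
  have "(norm (T k))\<^sup>2 \<le> (d k)\<^sup>2 * C\<^sup>2" for k
    by (metis assms(1) norm_ge_zero power_mono power_mult_distrib)
  then show ?thesis
    unfolding H2_def
    using summable_comparison_test'[of "\<lambda>k. (d k)\<^sup>2 * C\<^sup>2" 0 "\<lambda>k. (norm (T k))\<^sup>2"] assms(2)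
    by (simp add: summable_mult2)
qed

text \<open>The n-th functional is the n-th coordinate of \<open>T\<close> and the n-th vector is
  the unit vector \<open>e n\<close> of norm 1, so the nuclear series is just the sum of
  \<open>d\<close>. The remainder after N terms is a tail of the convergent series of
  \<open>norm (T a k)\<close>.\<close>

lemma nuclear_op_AT_of_coordinate_bounds:
  assumes add: "\<And>a b k. a \<in> X \<Longrightarrow> b \<in> X \<Longrightarrow> T (\<lambda>i. a i + b i) k = T a k + T b k"
    and scale: "\<And>a s k. a \<in> X \<Longrightarrow> T (\<lambda>i. s * a i) k = s * T a k"
    and bound: "\<And>a k. a \<in> X \<Longrightarrow> norm (T a k) \<le> d k * nX a"
    and nonneg: "\<And>k. 0 \<le> d k" and "summable d"
  shows "nuclear_op X nX AT AT_norm T"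
proof -
  define e :: "nat \<Rightarrow> cseq" where "e = (\<lambda>n k. of_bool (k = n))"
  have e_sums: "(\<lambda>k. norm (e n k)) sums 1" for n
    using sums_single[of n "\<lambda>_. 1::real"] by (simp add: e_def of_bool_def if_distrib cong: if_cong)
  have e: "e n \<in> AT" "AT_norm (e n) = 1" for n
    using e_sums[of n] by (auto simp: AT_def AT_norm_def sums_iff)
  have lim: "(\<lambda>N. AT_norm (\<lambda>k. T a k - (\<Sum>n<N. T a n * e n k))) \<longlonglongrightarrow> 0" if a: "a \<in> X" for a
  proof -
    have sm: "summable (\<lambda>k. norm (T a k))"
      using AT_of_coordinate_bound[OF bound[OF a] \<open>summable d\<close>] by (simp add: AT_def)
    have "AT_norm (\<lambda>k. T a k - (\<Sum>n<N. T a n * e n k))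
        = (\<Sum>k. norm (T a k)) - (\<Sum>k<N. norm (T a k))" for N
    proof -
      \<comment> \<open>Subtracting the first N terms clears the coordinates below N and leaves the
        others untouched.\<close>
      have "norm (T a k - (\<Sum>n<N. T a n * e n k))
          = norm (T a k) - (if k \<in> {..<N} then norm (T a k) else 0)" for k
        by (simp add: e_def of_bool_def if_distrib cong: if_cong)
      moreover have "(\<lambda>k. norm (T a k) - (if k \<in> {..<N} then norm (T a k) else 0)) sums
          ((\<Sum>k. norm (T a k)) - (\<Sum>k<N. norm (T a k)))"
        by (intro sums_diff summable_sums sm sums_If_finite_set) auto
      ultimately show ?thesis by (simp add: AT_norm_def sums_iff)
    qed
    moreover have "(\<lambda>N. (\<Sum>k. norm (T a k)) - (\<Sum>k<N. norm (T a k))) \<longlonglongrightarrow>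
        (\<Sum>k. norm (T a k)) - (\<Sum>k. norm (T a k))"
      by (intro tendsto_diff tendsto_const summable_LIMSEQ sm)
    ultimately show ?thesis by simp
  qed
  show ?thesis
    unfolding nuclear_op_def
    by (rule exI[of _ "\<lambda>n a. T a n"], rule exI[of _ e], rule exI[of _ d])
       (use assms e lim in auto)
qed

text \<open>The images of a bounded sequence lie in the box \<open>\<bar>x\<^sub>k\<bar> \<le> B d\<^sub>k\<close>, which is
  compact for coordinatewise convergence; Tannery's theorem upgrades this to norm convergence.\<close>

lemma compact_op_H2_of_coordinate_bounds:
  assumes bound: "\<And>a k. a \<in> X \<Longrightarrow> norm (T a k) \<le> d k * nX a"
    and nonneg: "\<And>k. 0 \<le> d k" and sm: "summable (\<lambda>k. (d k)\<^sup>2)"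
  shows "compact_op X nX H2 H2_norm T"
  unfolding compact_op_def
proof (intro allI impI, elim conjE)
  fix s :: "nat \<Rightarrow> cseq"
  assume s: "\<forall>j. s j \<in> X" and "bounded (range (\<lambda>j. nX (s j)))"
  then obtain B where B: "B > 0" "\<And>j. \<bar>nX (s j)\<bar> \<le> B"
    by (force simp: bounded_pos)
  have TB: "norm (T (s j) k) \<le> d k * B" for j k
  proof -
    have "norm (T (s j) k) \<le> d k * nX (s j)" using bound s by blast
    also have "\<dots> \<le> d k * B"
      using B(2)[of j] nonneg by (intro mult_left_mono) auto
    finally show ?thesis .
  qed
  \<comment> \<open>Extracting the subsequence needs one bound for all coordinates: every
    \<open>d k\<close> is at most the l^2 norm of \<open>d\<close>.\<close>
  have "d k \<le> sqrt (\<Sum>k. (d k)\<^sup>2)" for k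
  proof (rule real_le_rsqrt)
    show "(d k)\<^sup>2 \<le> (\<Sum>k. (d k)\<^sup>2)"
      using sum_le_suminf[OF sm, of "{k}"] by simp
  qed
  then have unif: "norm (T (s j) k) \<le> sqrt (\<Sum>k. (d k)\<^sup>2) * B" for j k
    by (meson TB B(1) order_trans mult_right_mono less_imp_le)
  obtain \<sigma> where \<sigma>: "strict_mono \<sigma>" and "\<And>k. \<exists>l. (\<lambda>j. T (s (\<sigma> j)) k) \<longlonglongrightarrow> l"
    by (rule function_convergent_subsequence[of "UNIV::nat set" "\<lambda>j. T (s j)", OF _ unif]) auto
  then obtain L where L: "\<And>k. (\<lambda>j. T (s (\<sigma> j)) k) \<longlonglongrightarrow> L k"
    by metis
  \<comment> \<open>The limit inherits the box bound. This puts \<open>L\<close> in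
    \<open>H2\<close> and, by the triangle inequality, gives the factor \<open>2 * B\<close>
    below.\<close>
  have LB: "norm (L k) \<le> d k * B" for k
    by (rule Lim_bounded[OF tendsto_norm[OF L], of 0]) (use TB in auto)
  have dominated: "(norm (T (s (\<sigma> j)) k - L k))\<^sup>2 \<le> (d k)\<^sup>2 * (2 * B)\<^sup>2" for j k
  proof -
    have "norm (T (s (\<sigma> j)) k - L k) \<le> d k * (2 * B)"
      using norm_triangle_ineq4[of "T (s (\<sigma> j)) k" "L k"] TB[of "\<sigma> j" k] LB[of k] by simp
    then show ?thesis
      by (metis norm_ge_zero power_mono power_mult_distrib)
  qed
  have lim0: "(\<lambda>j. (norm (T (s (\<sigma> j)) k - L k))\<^sup>2) \<longlonglongrightarrow> 0" for k
    using tendsto_power[OF tendsto_norm[OF tendsto_diff[OF L[of k] tendsto_const[of "L k"]]], of 2]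
    by simp
  have "(\<lambda>j. \<Sum>k. (norm (T (s (\<sigma> j)) k - L k))\<^sup>2) \<longlonglongrightarrow> (\<Sum>k::nat. 0)"
    using tannerys_theorem[of "\<lambda>k j. (norm (T (s (\<sigma> j)) k - L k))\<^sup>2" "\<lambda>_. 0" sequentially
        "\<lambda>k. (d k)\<^sup>2 * (2 * B)\<^sup>2", OF lim0 _ summable_mult2[OF sm]] dominated
    by (simp add: always_eventually)
  then have "(\<lambda>j. H2_norm (\<lambda>k. T (s (\<sigma> j)) k - L k)) \<longlonglongrightarrow> sqrt 0"
    unfolding H2_norm_def by (intro tendsto_real_sqrt) simp
  moreover have "L \<in> H2"
    using H2_of_coordinate_bound[OF LB sm] .
  ultimately show "\<exists>\<sigma> L. strict_mono \<sigma> \<and> L \<in> H2 \<and>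
      (\<lambda>j. H2_norm (\<lambda>k. T (s (\<sigma> j)) k - L k)) \<longlonglongrightarrow> 0"
    using \<sigma> by auto
qed

subsection \<open>Landau's bound for Taylor partial sums\<close>

text \<open>The Taylor coefficients of \<open>(1 - z)\<^bsup>-1/2\<^esup>\<close>.\<close>

definition landau_coeff :: "nat \<Rightarrow> real" where
  "landau_coeff k = (- 1) ^ k * ((- 1 / 2) gchoose k)"

text \<open>Squaring (1 - z)^(-1/2) gives the geometric series 1/(1 - z), whose coefficients are all
  1. In coefficients this is Vandermonde's identity with -1/2 - 1/2 = -1.\<close>

lemma landau_coeff_convolution: "(\<Sum>k\<le>n. landau_coeff k * landau_coeff (n - k)) = 1"
proof -
  have "(\<Sum>k\<le>n. landau_coeff k * landau_coeff (n - k))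
      = (\<Sum>k\<le>n. (- 1) ^ n * (((- 1 / 2) gchoose k) * ((- 1 / 2) gchoose (n - k))))"
    by (intro sum.cong) (auto simp: landau_coeff_def algebra_simps simp flip: power_add)
  also have "\<dots> = (- 1) ^ n * ((- 1 / 2 + - 1 / 2 :: real) gchoose n)"
    unfolding gbinomial_Vandermonde[symmetric] sum_distrib_left atMost_atLeast0 ..
  also have "\<dots> = 1"
    using gbinomial_minus[of "1::real" n]
    by (simp add: binomial_gbinomial[symmetric] flip: power_add)
  finally show ?thesis .
qed

lemma landau_coeff_Suc: "landau_coeff (Suc k) = landau_coeff k * ((2 * real k + 1) / (2 * real k + 2))"
proof -
  have "(- 1 / 2 :: real) * ((- 1 / 2) gchoose k)
      = real k * ((- 1 / 2) gchoose k) + real (Suc k) * ((- 1 / 2) gchoose (Suc k))"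
    by (rule gbinomial_mult_1)
  then have "((- 1 / 2 :: real) gchoose (Suc k)) * (2 * real k + 2)
      = - ((- 1 / 2) gchoose k) * (2 * real k + 1)"
    by (simp add: algebra_simps)
  then have "((- 1 / 2 :: real) gchoose (Suc k))
      = - ((- 1 / 2) gchoose k) * (2 * real k + 1) / (2 * real k + 2)"
    by (intro eq_divide_imp) auto
  then show ?thesis by (simp add: landau_coeff_def)
qed

text \<open>The comparison with a harmonic term is what produces the logarithm. The induction closes
  because ((2k+1)/(2k+2))^2 is at most (k+1)/(k+2).\<close>

lemma landau_coeff_sq_le: "(landau_coeff k)\<^sup>2 \<le> 1 / (real k + 1)"
proof (induction k)
  case 0
  then show ?case by (simp add: landau_coeff_def)
next
  case (Suc k)
  have "(landau_coeff (Suc k))\<^sup>2 = (landau_coeff k)\<^sup>2 * ((2 * real k + 1) / (2 * real k + 2))\<^sup>2"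
    by (simp only: landau_coeff_Suc power_mult_distrib)
  also have "\<dots> \<le> 1 / (real k + 1) * ((2 * real k + 1) / (2 * real k + 2))\<^sup>2"
    using Suc by (rule mult_right_mono) simp
  also have "\<dots> \<le> 1 / (real (Suc k) + 1)"
  proof -
    have "(2 * real k + 1)\<^sup>2 * (real k + 2) \<le> (real k + 1) * (2 * real k + 2)\<^sup>2"
      by (simp add: power2_eq_square algebra_simps)
    then show ?thesis
      by (simp add: power_divide divide_simps) (simp add: algebra_simps)
  qed
  finally show ?case .
qed

lemma harm_Suc_le: "harm (Suc n) \<le> 1 + ln (real (Suc n))"
  using decseqD[OF decseq_harm_diff_ln, of 0 n] by (simp add: harm_expand)

lemma sum_landau_coeff_sq_le: "(\<Sum>k\<le>n. (landau_coeff k)\<^sup>2) \<le> 1 + ln (real (Suc n))"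
proof -
  have "(\<Sum>k\<le>n. (landau_coeff k)\<^sup>2) \<le> (\<Sum>k\<le>n. 1 / (real k + 1))"
    by (intro sum_mono landau_coeff_sq_le)
  also have "\<dots> = harm (Suc n)"
    by (simp add: harm_altdef lessThan_Suc_atMost inverse_eq_divide add.commute)
  finally show ?thesis using harm_Suc_le[of n] by linarith
qed

section \<open>Discrete Fourier analysis on the N-th roots of unity\<close>

lemma roots_of_unity_orthogonal:
  assumes "p < N" "q < N"
  shows "(\<Sum>j<N. cis (2 * pi * real j / real N) ^ p * cnj (cis (2 * pi * real j / real N)) ^ q)
       = of_bool (p = q) * of_nat N"
proof -
  define \<theta> where "\<theta> = 2 * pi * (real p - real q) / real N"
  have N: "N > 0" using assms by simp
  have term_eq: "cis (2 * pi * real j / real N) ^ p * cnj (cis (2 * pi * real j / real N)) ^ q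
      = cis \<theta> ^ j" for j
    by (simp add: Complex.DeMoivre cis_mult cis_cnj \<theta>_def diff_divide_distrib algebra_simps)
  show ?thesis
  proof (cases "p = q")
    case True
    then show ?thesis unfolding term_eq by (simp add: \<theta>_def)
  next
    case False
    \<comment> \<open>Otherwise N would divide p - q, which is nonzero and of modulus below N. The
      sum is then geometric with a ratio other than 1, and vanishes since the ratio is an N-th root
      of unity.\<close>
    have "cis \<theta> \<noteq> 1"
    proof
      assume "cis \<theta> = 1"
      then have "cos \<theta> = 1" by (metis cis.sel(1) one_complex.sel(1))
      then obtain m :: int where "\<theta> = of_int m * (2 * pi)"
        by (auto simp: cos_one_2pi_int)
      then have "real p - real q = of_int m * real N"
        using N by (simp add: \<theta>_def divide_simps)
      then have "int p - int q = m * int N"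
        by (metis of_int_diff of_int_eq_iff of_int_mult of_int_of_nat_eq)
      then have "int N dvd int p - int q" by simp
      moreover have "\<bar>int p - int q\<bar> < int N" using assms by linarith
      ultimately show False
        using False zdvd_imp_le[of "int N" "\<bar>int p - int q\<bar>"] by auto
    qed
    moreover have "cis \<theta> ^ N = 1"
    proof -
      have "cis \<theta> ^ N = cis (2 * pi * of_int (int p - int q))"
        using N by (simp add: Complex.DeMoivre \<theta>_def)
      then show ?thesis by (metis cis_multiple_2pi Ints_of_int)
    qed
    ultimately show ?thesis
      unfolding term_eq using False by (simp add: sum_gp_strict)
  qed
qed

text \<open>A finite mean replaces the contour integral for a Fourier coefficient. It is exact
  because \<open>degree u < N\<close> and \<open>q < N\<close> rule out aliasing.\<close>

lemma poly_coeff_eq_mean: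
  fixes u :: "complex poly"
  assumes "degree u < N" "q < N"
  shows "(\<Sum>j<N. poly u (cis (2 * pi * real j / real N)) * cnj (cis (2 * pi * real j / real N)) ^ q)
       = of_nat N * coeff u q"
proof -
  let ?z = "\<lambda>j. cis (2 * pi * real j / real N)"
  have "(\<Sum>j<N. poly u (?z j) * cnj (?z j) ^ q)
      = (\<Sum>j<N. \<Sum>i\<le>degree u. coeff u i * (?z j ^ i * cnj (?z j) ^ q))"
    by (simp add: poly_altdef sum_distrib_right mult.assoc)
  also have "\<dots> = (\<Sum>i\<le>degree u. coeff u i * (\<Sum>j<N. ?z j ^ i * cnj (?z j) ^ q))"
    by (subst sum.swap) (simp add: sum_distrib_left)
  also have "\<dots> = (\<Sum>i\<le>degree u. coeff u i * (of_bool (i = q) * of_nat N))"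
    using assms by (intro sum.cong refl) (simp add: roots_of_unity_orthogonal)
  also have "\<dots> = of_nat N * coeff u q"
    by (auto simp: of_bool_def if_distrib[where f="\<lambda>x. _ * x"] if_distrib[where f="\<lambda>x. x * _"]
        coeff_eq_0 cong: if_cong)
  finally show ?thesis .
qed

lemma poly_parseval_roots_of_unity:
  fixes u :: "complex poly"
  assumes "degree u < N"
  shows "(\<Sum>j<N. (norm (poly u (cis (2 * pi * real j / real N))))\<^sup>2)
       = real N * (\<Sum>i\<le>degree u. (norm (coeff u i))\<^sup>2)"
proof -
  let ?z = "\<lambda>j. cis (2 * pi * real j / real N)"
  have "complex_of_real (\<Sum>j<N. (norm (poly u (?z j)))\<^sup>2)
      = (\<Sum>j<N. poly u (?z j) * cnj (poly u (?z j)))"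
    by (simp add: complex_norm_square[symmetric] del: of_real_power)
  \<comment> \<open>Only the conjugated factor is expanded, so that the sum over j becomes the
    coefficient formula just proved.\<close>
  also have "\<dots> = (\<Sum>j<N. \<Sum>i\<le>degree u. cnj (coeff u i) * (poly u (?z j) * cnj (?z j) ^ i))"
    by (simp add: poly_altdef[of u "cis _"] sum_distrib_left algebra_simps)
  also have "\<dots> = (\<Sum>i\<le>degree u. cnj (coeff u i) * (\<Sum>j<N. poly u (?z j) * cnj (?z j) ^ i))"
    by (subst sum.swap) (simp add: sum_distrib_left)
  also have "\<dots> = (\<Sum>i\<le>degree u. cnj (coeff u i) * (of_nat N * coeff u i))"
    using assms by (intro sum.cong refl) (simp add: poly_coeff_eq_mean)
  also have "\<dots> = complex_of_real (real N * (\<Sum>i\<le>degree u. (norm (coeff u i))\<^sup>2))"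
    by (simp add: sum_distrib_left complex_norm_square algebra_simps del: of_real_power)
  finally show ?thesis using of_real_eq_iff by blast
qed

text \<open>Landau's argument: with \<open>K\<close> a truncation of \<open>(1 - z)\<^bsup>-1/2\<^esup>\<close>, the partial sum of the
  coefficients of \<open>p\<close> is a Fourier coefficient of \<open>p K\<^sup>2\<close>, hence at most the mean of
  \<open>\<bar>p\<bar> \<bar>K\<bar>\<^sup>2\<close> over the circle.\<close>

lemma norm_sum_coeff_poly_le:
  fixes p :: "complex poly"
  assumes B: "\<And>z. norm z = 1 \<Longrightarrow> norm (poly p z) \<le> B"
  shows "norm (\<Sum>i\<le>n. coeff p i) \<le> B * (1 + ln (real (Suc n)))"
proof -
  define K :: "complex poly" where "K = (\<Sum>k\<le>n. monom (complex_of_real (landau_coeff k)) k)"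
  have coeff_K: "coeff K i = (if i \<le> n then complex_of_real (landau_coeff i) else 0)" for i
    by (simp add: K_def coeff_sum)
  \<comment> \<open>Coefficients of \<open>K * K\<close> up to n involve only those of
    \<open>K\<close> up to n, so the truncation does not disturb the convolution identity.\<close>
  have coeff_KK: "coeff (K * K) m = 1" if "m \<le> n" for m
  proof -
    have "coeff (K * K) m
        = (\<Sum>i\<le>m. complex_of_real (landau_coeff i * landau_coeff (m - i)))"
      unfolding coeff_mult using that by (intro sum.cong) (auto simp: coeff_K)
    also have "\<dots> = 1"
      by (simp only: of_real_sum[symmetric] landau_coeff_convolution of_real_1)
    finally show ?thesis .
  qed
  \<comment> \<open>\<open>N\<close> exceeds both degrees and n, so the coefficient formula and the
    Parseval identity hold at the same nodes.\<close>
  define N where "N = degree (p * (K * K)) + degree K + n + 1"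
  let ?z = "\<lambda>j. cis (2 * pi * real j / real N)"
  have N: "N > 0" "degree (p * (K * K)) < N" "degree K < N" "n < N"
    by (auto simp: N_def)
  have B0: "B \<ge> 0" using order_trans[OF norm_ge_zero B[of 1]] by simp
  have "of_nat N * (\<Sum>i\<le>n. coeff p i) = of_nat N * coeff (p * (K * K)) n"
    by (simp add: coeff_mult[of p] coeff_KK)
  also have "\<dots> = (\<Sum>j<N. poly (p * (K * K)) (?z j) * cnj (?z j) ^ n)"
    using N by (intro poly_coeff_eq_mean[symmetric])
  finally have "real N * norm (\<Sum>i\<le>n. coeff p i)
      = norm (\<Sum>j<N. poly (p * (K * K)) (?z j) * cnj (?z j) ^ n)"
    by (metis norm_mult norm_of_nat)
  also have "\<dots> \<le> (\<Sum>j<N. B * (norm (poly K (?z j)))\<^sup>2)"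
    using B by (intro sum_norm_le)
      (auto simp: norm_mult norm_power power2_eq_square intro!: mult_right_mono)
  also have "\<dots> = real N * (B * (\<Sum>i\<le>degree K. (norm (coeff K i))\<^sup>2))"
    using N by (simp add: poly_parseval_roots_of_unity flip: sum_distrib_left)
  finally have "norm (\<Sum>i\<le>n. coeff p i) \<le> B * (\<Sum>i\<le>degree K. (norm (coeff K i))\<^sup>2)"
    using N by simp
  also have "(\<Sum>i\<le>degree K. (norm (coeff K i))\<^sup>2) \<le> (\<Sum>i\<le>n. (landau_coeff i)\<^sup>2)"
  proof -
    have "degree K \<le> n" by (rule degree_le) (simp add: coeff_K)
    then show ?thesis by (intro sum_le_included[where i=id]) (auto simp: coeff_K)
  qed
  also have "\<dots> \<le> 1 + ln (real (Suc n))" by (rule sum_landau_coeff_sq_le)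
  finally show ?thesis using B0 by (simp add: mult_left_mono)
qed

section \<open>From polynomials to bounded holomorphic functions\<close>

lemma norm_le_Hinf_norm:
  assumes "a \<in> Hinf" "norm z < 1"
  shows "norm (\<Sum>n. a n * z ^ n) \<le> Hinf_norm a"
proof -
  have "bounded ((\<lambda>z. norm (\<Sum>n. a n * z ^ n)) ` ball 0 1)"
    using assms(1) by (auto simp: Hinf_def bounded_iff)
  then show ?thesis
    unfolding Hinf_norm_def using assms(2)
    by (intro cSUP_upper) (auto simp: bounded_imp_bdd_above)
qed

lemma Hinf_norm_nonneg: "a \<in> Hinf \<Longrightarrow> 0 \<le> Hinf_norm a"
  by (rule order_trans[OF norm_ge_zero norm_le_Hinf_norm[of a 0]]) auto

text \<open>Dilating by \<rho> < 1 makes the series converge absolutely on the unit circle, where a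
  polynomial section is within e of the dilated function and the polynomial bound applies. Then e
  tends to 0 and \<rho> to 1.\<close>

lemma norm_partial_sum_Hinf_le:
  assumes a: "a \<in> Hinf"
  shows "norm (\<Sum>i\<le>n. a i) \<le> (1 + ln (real (Suc n))) * Hinf_norm a"
proof -
  let ?L = "1 + ln (real (Suc n))"
  have L: "?L > 0" using ln_ge_zero[of "real (Suc n)"] by linarith
  have inner: "norm (\<Sum>i\<le>n. a i * complex_of_real \<rho> ^ i) \<le> Hinf_norm a * ?L"
    if \<rho>: "0 < \<rho>" "\<rho> < 1" for \<rho> :: real
  proof -
    obtain \<rho>' where \<rho>': "\<rho> < \<rho>'" "\<rho>' < 1" using dense \<rho> by blast
    have "summable (\<lambda>i. a i * complex_of_real \<rho>' ^ i)"
      using a \<rho> \<rho>' by (simp add: Hinf_def)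
    then have abs: "summable (\<lambda>i. norm (a i * complex_of_real \<rho> ^ i))"
      by (rule powser_insidea) (use \<rho> \<rho>' in simp)
    have approx: "norm (\<Sum>i\<le>n. a i * complex_of_real \<rho> ^ i) \<le> (Hinf_norm a + e) * ?L" if e: "e > 0" for e
    proof -
      obtain D0 where D0: "\<And>D. D \<ge> D0 \<Longrightarrow> norm (\<Sum>i. norm (a (i + D) * complex_of_real \<rho> ^ (i + D))) < e"
        using suminf_exist_split[OF e abs] by blast
      \<comment> \<open>\<open>D0\<close> makes the discarded tail smaller than e, and
        \<open>Suc n\<close> ensures that the section keeps all coefficients up to n.\<close>
      define D where "D = max D0 (Suc n)"
      define p where "p = (\<Sum>i<D. monom (a i * complex_of_real \<rho> ^ i) i)"
      have coeff_p: "coeff p i = a i * complex_of_real \<rho> ^ i" if "i \<le> n" for i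
        using that by (simp add: p_def coeff_sum D_def)
      have "norm (poly p z) \<le> Hinf_norm a + e" if z: "norm z = 1" for z
      proof -
        let ?g = "\<lambda>i. a i * (complex_of_real \<rho> * z) ^ i"
        have ng: "norm (?g i) = norm (a i * complex_of_real \<rho> ^ i)" for i
          using z by (simp add: norm_mult norm_power)
        have sg: "summable (\<lambda>i. norm (?g i))" using abs by (simp add: ng)
        have pz: "poly p z = (\<Sum>i<D. ?g i)"
          by (simp add: p_def poly_sum poly_monom power_mult_distrib mult.assoc)
        have "poly p z = (\<Sum>i. ?g i) - (\<Sum>i. ?g (i + D))"
          using suminf_minus_initial_segment[OF summable_norm_cancel[OF sg], of D]
          by (simp add: pz)
        then have "norm (poly p z) \<le> norm (\<Sum>i. ?g i) + norm (\<Sum>i. ?g (i + D))"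
          by (simp add: norm_triangle_ineq4)
        also have "norm (\<Sum>i. ?g i) \<le> Hinf_norm a"
          using \<rho> z by (intro norm_le_Hinf_norm a) (simp add: norm_mult)
        also have "norm (\<Sum>i. ?g (i + D)) \<le> (\<Sum>i. norm (?g (i + D)))"
          using sg by (intro summable_norm) (rule summable_ignore_initial_segment)
        also have "\<dots> = (\<Sum>i. norm (a (i + D) * complex_of_real \<rho> ^ (i + D)))"
          by (simp only: ng)
        also have "\<dots> \<le> e"
          using D0[of D] by (simp add: D_def)
        finally show ?thesis by simp
      qed
      from norm_sum_coeff_poly_le[of p, OF this, of n] show ?thesis
        by (simp add: coeff_p)
    qed
    have "norm (\<Sum>i\<le>n. a i * complex_of_real \<rho> ^ i) \<le> Hinf_norm a * ?L + e" if "e > 0" for e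
    proof -
      have "e / ?L > 0" using \<open>e > 0\<close> L by simp
      from approx[OF this] have "norm (\<Sum>i\<le>n. a i * complex_of_real \<rho> ^ i) \<le> Hinf_norm a * ?L + e / ?L * ?L"
        by (simp only: distrib_right)
      then show ?thesis using L by simp
    qed
    then show ?thesis by (rule field_le_epsilon)
  qed
  \<comment> \<open>For fixed n the sum is finite, hence continuous in \<rho>, and the bound does
    not depend on \<rho>.\<close>
  have "((\<lambda>\<rho>. norm (\<Sum>i\<le>n. a i * complex_of_real \<rho> ^ i)) \<longlongrightarrow>
      norm (\<Sum>i\<le>n. a i * complex_of_real 1 ^ i)) (at_left 1)"
    by (intro tendsto_intros)
  moreover have "eventually (\<lambda>\<rho>::real. norm (\<Sum>i\<le>n. a i * complex_of_real \<rho> ^ i) \<le> Hinf_norm a * ?L)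
      (at_left 1)"
    by (rule eventually_mono[OF eventually_at_left_real[of 0 "1::real"]]) (use inner in auto)
  ultimately have "norm (\<Sum>i\<le>n. a i * complex_of_real 1 ^ i) \<le> Hinf_norm a * ?L"
    by (rule tendsto_upperbound) simp
  then show ?thesis by (simp add: mult.commute)
qed

subsection \<open>Moments of Carleson measures\<close>

lemma AE_in_01:
  assumes "measure_on_01 \<mu>"
  shows "AE t in \<mu>. 0 \<le> t \<and> t < 1"
proof (rule AE_I')
  show "UNIV - {0..<1} \<in> null_sets \<mu>"
    using assms unfolding measure_on_01_def by (intro null_setsI) simp_all
qed auto

lemma integrable_power_01:
  assumes "measure_on_01 \<mu>"
  shows "integrable \<mu> (\<lambda>t. t ^ n)"
proof -
  interpret finite_measure \<mu> using assms by (simp add: measure_on_01_def)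
  have [measurable_cong]: "sets \<mu> = sets borel" using assms by (simp add: measure_on_01_def)
  show ?thesis
  proof (rule integrable_const_bound[of _ 1])
    show "AE t in \<mu>. norm (t ^ n) \<le> 1"
      using AE_in_01[OF assms] by eventually_elim (simp add: power_le_one norm_power)
  qed measurable
qed

lemma moment_nonneg:
  assumes "measure_on_01 \<mu>"
  shows "0 \<le> moment \<mu> n"
  unfolding moment_def
proof (rule integral_nonneg_AE)
  show "AE t in \<mu>. 0 \<le> t ^ n"
    using AE_in_01[OF assms] by eventually_elim simp
qed

text \<open>The O-bound controls only \<open>t\<close> near 1. Further left the tail is at most the
  total mass while (1 - t)^r is at least (1 - b)^r, so the constant \<open>M\<close> takes over.
  Negative \<open>t\<close> are included because the outermost layer used below starts left of
  0.\<close>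

lemma Carleson_tail_bound:
  assumes \<mu>: "measure_on_01 \<mu>" and "r \<ge> 0" and "r_Carleson r \<mu>"
  obtains C where "C \<ge> 0" "\<And>t. t < 1 \<Longrightarrow> measure \<mu> {t..<1} \<le> C * (1 - t) powr r"
proof -
  interpret finite_measure \<mu> using \<mu> by (simp add: measure_on_01_def)
  obtain c where c: "c > 0"
    and "eventually (\<lambda>t. norm (measure \<mu> {t..<1}) \<le> c * norm ((1 - t) powr r)) (at_left 1)"
    using assms(3) unfolding r_Carleson_def by (elim landau_o.bigE)
  then obtain b where b: "b < 1" "\<And>t. b < t \<Longrightarrow> t < 1 \<Longrightarrow> measure \<mu> {t..<1} \<le> c * (1 - t) powr r"
    by (auto simp: eventually_at_left_field)
  define M where "M = measure \<mu> (space \<mu>) / (1 - b) powr r"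
  have "measure \<mu> {t..<1} \<le> (c + M) * (1 - t) powr r" if t: "t < 1" for t
  proof (cases "b < t")
    case True
    have "0 \<le> M * (1 - t) powr r" by (simp add: M_def)
    then show ?thesis using b(2)[OF True t] by (simp add: distrib_right)
  next
    case False
    have "measure \<mu> {t..<1} \<le> M * (1 - b) powr r"
      using b(1) bounded_measure by (simp add: M_def)
    also have "\<dots> \<le> M * (1 - t) powr r"
      using False b \<open>r \<ge> 0\<close> by (intro mult_left_mono powr_mono2) (auto simp: M_def)
    also have "\<dots> \<le> (c + M) * (1 - t) powr r"
      using c by (simp add: distrib_right)
    finally show ?thesis .
  qed
  moreover have "c + M \<ge> 0" using c by (simp add: M_def)
  ultimately show thesis using that by blast
qed

text \<open>The layer \<open>j \<le> (n + 1)(1 - t) < j + 1\<close> contributes at most \<open>e\<^bsup>1-j\<^esup>\<close> times the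
  tail \<open>\<mu>[1 - (j + 1)/(n + 1), 1)\<close>.\<close>

lemma power_le_layers:
  fixes t :: real
  assumes t: "0 \<le> t" "t < 1"
  shows "t ^ n \<le> (\<Sum>j\<le>Suc n. exp (1 - real j) * indicator {1 - real (Suc j) / real (Suc n)..<1} t)"
proof -
  define x where "x = real (Suc n) * (1 - t)"
  define j where "j = nat \<lfloor>x\<rfloor>"
  have x: "0 \<le> x" "x \<le> real (Suc n)"
    using t mult_left_mono[of "1 - t" 1 "real (Suc n)"] by (auto simp: x_def)
  have j: "real j \<le> x" "x < real j + 1"
    using x by (auto simp: j_def)
  \<comment> \<open>At t = 0 one has x = n + 1, so the sum must run up to index n + 1.\<close>
  have "j \<le> Suc n" using j x by linarith
  have "t ^ n \<le> exp (t - 1) ^ n"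
    using exp_ge_add_one_self[of "t - 1"] t by (intro power_mono) auto
  also have "\<dots> = exp (real n * (t - 1))" by (simp add: exp_of_nat_mult)
  \<comment> \<open>The exponent is (1 - t) - x, with 1 - t at most 1 and x at least j. The 1 pays
    for passing from n + 1 to n.\<close>
  also have "\<dots> \<le> exp (1 - real j)"
    using j t by (simp add: x_def algebra_simps)
  also have "\<dots> = exp (1 - real j) * indicator {1 - real (Suc j) / real (Suc n)..<1} t"
    using j(2) t by (simp add: x_def field_simps indicator_def)
  also have "\<dots> \<le> (\<Sum>j\<le>Suc n. exp (1 - real j) * indicator {1 - real (Suc j) / real (Suc n)..<1} t)"
    using \<open>j \<le> Suc n\<close>
    by (intro member_le_sum[of j _ "\<lambda>j. exp (1 - real j) * indicator {1 - real (Suc j) / real (Suc n)..<1} t"]) auto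
  finally show ?thesis .
qed

lemma summable_Suc_powr_exp: "summable (\<lambda>j. exp (1 - real j) * real (Suc j) powr r)"
proof (rule summable_comparison_test_bigo)
  show "summable (\<lambda>j. norm (1 / real j ^ 2))"
    using inverse_power_summable[of 2, where 'a=real] by (simp add: inverse_eq_divide)
  show "(\<lambda>j. exp (1 - real j) * real (Suc j) powr r) \<in> O(\<lambda>j. 1 / real j ^ 2)"
    by real_asymp
qed

text \<open>Integrating the layer bound, layer j contributes at most exp(1 - j) C ((j+1)/(n+1))^r.
  After (n+1)^(-r) is factored out, the remaining sum is at most the convergent series
  \<open>S\<close>, uniformly in n.\<close>

lemma moment_le_powr:
  assumes \<mu>: "measure_on_01 \<mu>" and "r \<ge> 0" and "r_Carleson r \<mu>"
  obtains C where "C \<ge> 0" "\<And>n. moment \<mu> n \<le> C * real (Suc n) powr - r"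
proof -
  interpret finite_measure \<mu> using \<mu> by (simp add: measure_on_01_def)
  have [measurable_cong]: "sets \<mu> = sets borel" using \<mu> by (simp add: measure_on_01_def)
  obtain C where C: "C \<ge> 0" "\<And>t. t < 1 \<Longrightarrow> measure \<mu> {t..<1} \<le> C * (1 - t) powr r"
    using Carleson_tail_bound[OF assms] by blast
  define S where "S = (\<Sum>j. exp (1 - real j) * real (Suc j) powr r)"
  have S: "S \<ge> 0" unfolding S_def by (intro suminf_nonneg summable_Suc_powr_exp) simp
  have "moment \<mu> n \<le> (C * S) * real (Suc n) powr - r" for n
  proof -
    let ?I = "\<lambda>j. {1 - real (Suc j) / real (Suc n)..<1}"
    have int: "integrable \<mu> (\<lambda>t. exp (1 - real j) * indicator (?I j) t)" for j
      by (intro integrable_mult_right integrable_real_indicator) (auto simp: emeasure_eq_measure)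
    have "moment \<mu> n \<le> (\<integral>t. (\<Sum>j\<le>Suc n. exp (1 - real j) * indicator (?I j) t) \<partial>\<mu>)"
      unfolding moment_def
    proof (intro integral_mono_AE integrable_power_01 \<mu> Bochner_Integration.integrable_sum int)
      show "AE t in \<mu>. t ^ n \<le> (\<Sum>j\<le>Suc n. exp (1 - real j) * indicator (?I j) t)"
        using AE_in_01[OF \<mu>] by eventually_elim (blast intro: power_le_layers)
    qed
    also have "\<dots> = (\<Sum>j\<le>Suc n. exp (1 - real j) * measure \<mu> (?I j))"
      using int by (subst Bochner_Integration.integral_sum) simp_all
    also have "\<dots> \<le> (\<Sum>j\<le>Suc n. C * real (Suc n) powr - r * (exp (1 - real j) * real (Suc j) powr r))"
    proof (rule sum_mono)
      fix j
      have "measure \<mu> (?I j) \<le> C * (1 - (1 - real (Suc j) / real (Suc n))) powr r"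
        by (rule C(2)) simp
      also have "\<dots> = C * (real (Suc j) powr r * real (Suc n) powr - r)"
        by (simp add: powr_divide powr_minus_divide)
      finally show "exp (1 - real j) * measure \<mu> (?I j)
          \<le> C * real (Suc n) powr - r * (exp (1 - real j) * real (Suc j) powr r)"
        using mult_left_mono[of _ _ "exp (1 - real j)"] by (fastforce simp: mult_ac)
    qed
    also have "\<dots> = C * real (Suc n) powr - r * (\<Sum>j\<le>Suc n. exp (1 - real j) * real (Suc j) powr r)"
      by (rule sum_distrib_left[symmetric])
    also have "\<dots> \<le> C * real (Suc n) powr - r * S"
      unfolding S_def using C(1)
      by (intro mult_left_mono sum_le_suminf summable_Suc_powr_exp) auto
    finally show ?thesis by (simp add: mult_ac)
  qed
  then show thesis using that[of "C * S"] C(1) S by simp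
qed

lemma summable_Suc_powr_iff: "summable (\<lambda>n. real (Suc n) powr s) \<longleftrightarrow> s < - 1"
  using summable_Suc_iff[of "\<lambda>n. real n powr s"] summable_real_powr_iff[of s] by simp

lemma summable_Suc_powr_log:
  assumes "r > 1"
  shows "summable (\<lambda>n. real (Suc n) powr - r * (1 + ln (real (Suc n))))"
proof (rule summable_comparison_test')
  \<comment> \<open>The logarithm is absorbed into a power x^e that spends half of the excess r - 1,
    which leaves e - r < -1.\<close>
  define e where "e = (r - 1) / 2"
  have e: "e > 0" "e - r < - 1" using assms by (auto simp: e_def field_simps)
  show "summable (\<lambda>n. (1 + 1 / e) * real (Suc n) powr (e - r))"
    using e by (intro summable_mult) (simp only: summable_Suc_powr_iff)
  fix n
  have "1 + ln (real (Suc n)) \<le> (1 + 1 / e) * real (Suc n) powr e"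
    using ln_powr_bound[of "real (Suc n)" e] ge_one_powr_ge_zero[of "real (Suc n)" e] e
    by (simp add: distrib_right)
  then have "real (Suc n) powr - r * (1 + ln (real (Suc n)))
      \<le> real (Suc n) powr - r * ((1 + 1 / e) * real (Suc n) powr e)"
    by (intro mult_left_mono) auto
  also have "\<dots> = (1 + 1 / e) * (real (Suc n) powr - r * real (Suc n) powr e)"
    by simp
  also have "real (Suc n) powr - r * real (Suc n) powr e = real (Suc n) powr (e - r)"
    by (simp only: powr_add[symmetric] uminus_add_conv_diff)
  finally show "norm (real (Suc n) powr - r * (1 + ln (real (Suc n))))
      \<le> (1 + 1 / e) * real (Suc n) powr (e - r)"
    using ln_ge_zero[of "real (Suc n)"] by (simp add: abs_mult)
qed

subsection \<open>The Hardy space \<open>H\<^sup>2\<close>\<close>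

text \<open>The finite inequality bounds all partial sums by one constant, which yields both the
  summability and the estimate.\<close>

lemma H2_Cauchy_Schwarz:
  assumes "a \<in> H2" and w: "summable (\<lambda>n. (w n)\<^sup>2)"
  shows "summable (\<lambda>n. \<bar>w n\<bar> * norm (a n))"
    and "(\<Sum>n. \<bar>w n\<bar> * norm (a n)) \<le> sqrt (\<Sum>n. (w n)\<^sup>2) * H2_norm a"
proof -
  have a: "summable (\<lambda>n. (norm (a n))\<^sup>2)" using assms by (simp add: H2_def)
  have partial: "(\<Sum>n<N. \<bar>w n\<bar> * norm (a n)) \<le> sqrt (\<Sum>n. (w n)\<^sup>2) * H2_norm a" for N
  proof -
    have "(\<Sum>n<N. \<bar>w n\<bar> * norm (a n)) \<le> L2_set w {..<N} * L2_set (\<lambda>n. norm (a n)) {..<N}"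
      using L2_set_mult_ineq[of w "\<lambda>n. norm (a n)" "{..<N}"] by simp
    also have "\<dots> \<le> sqrt (\<Sum>n. (w n)\<^sup>2) * H2_norm a"
      unfolding L2_set_def H2_norm_def
      by (intro mult_mono real_sqrt_le_mono sum_le_suminf a w) (auto simp: suminf_nonneg w sum_nonneg)
    finally show ?thesis .
  qed
  show sm: "summable (\<lambda>n. \<bar>w n\<bar> * norm (a n))"
    by (rule summableI_nonneg_bounded[OF _ partial]) simp
  show "(\<Sum>n. \<bar>w n\<bar> * norm (a n)) \<le> sqrt (\<Sum>n. (w n)\<^sup>2) * H2_norm a"
    using suminf_le_const[OF sm partial] .
qed

lemma H2_norm_nonneg: "a \<in> H2 \<Longrightarrow> 0 \<le> H2_norm a"
  by (simp add: H2_norm_def H2_def suminf_nonneg)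

lemma summable_Suc_powr_sq:
  assumes "p > 1 / 2"
  shows "summable (\<lambda>n. (real (Suc n) powr - p)\<^sup>2)"
proof -
  have "(real (Suc n) powr - p)\<^sup>2 = real (Suc n) powr (- (2 * p))" for n
    by (simp add: power2_eq_square flip: powr_add)
  then show ?thesis using assms by (simp only: summable_Suc_powr_iff)
qed

text \<open>Instead of estimating \<open>\<Sum>\<^sub>n (n + k + 1)\<^bsup>-2r\<^esup>\<close> sharply, split the exponent:
  \<open>(n + k + 1)\<^bsup>-r\<^esup> \<le> (n + 1)\<^bsup>-(r-p)\<^esup> (k + 1)\<^bsup>-p\<^esup>\<close>. Any \<open>p < r - 1/2\<close> makes the first factor
  square summable, and this loss is harmless because the hypotheses on \<open>r\<close> are strict.\<close>

lemma Hankel_row_H2_bound: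
  assumes m: "\<And>n. 0 \<le> m n" "\<And>n. m n \<le> C * real (Suc n) powr - r" and C: "C \<ge> 0"
    and p: "0 \<le> p" "p < r - 1 / 2"
  obtains D where "D \<ge> 0"
    "\<And>a k. a \<in> H2 \<Longrightarrow> summable (\<lambda>n. norm (complex_of_real (m (n + k)) * a n))"
    "\<And>a k. a \<in> H2 \<Longrightarrow>
       (\<Sum>n. norm (complex_of_real (m (n + k)) * a n)) \<le> D * real (Suc k) powr - p * H2_norm a"
proof -
  let ?w = "\<lambda>n. real (Suc n) powr - (r - p)"
  have w: "summable (\<lambda>n. (?w n)\<^sup>2)" using p by (intro summable_Suc_powr_sq) simp
  have split: "m (n + k) \<le> C * real (Suc k) powr - p * ?w n" for n k
  proof -
    have "real (Suc (n + k)) powr - r = real (Suc (n + k)) powr - p * real (Suc (n + k)) powr - (r - p)"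
      by (simp flip: powr_add)
    also have "\<dots> \<le> real (Suc k) powr - p * ?w n"
      using p by (intro mult_mono powr_mono2') auto
    finally have "C * real (Suc (n + k)) powr - r \<le> C * (real (Suc k) powr - p * ?w n)"
      using C by (rule mult_left_mono)
    then show ?thesis using m(2)[of "n + k"] by (simp add: mult_ac)
  qed
  define D where "D = C * sqrt (\<Sum>n. (?w n)\<^sup>2)"
  have term_le: "norm (complex_of_real (m (n + k)) * a n)
      \<le> C * real (Suc k) powr - p * (\<bar>?w n\<bar> * norm (a n))" for a :: cseq and n k
    using mult_right_mono[OF split[of n k], of "norm (a n)"] m(1)[of "n + k"]
    by (simp add: norm_mult mult_ac)
  have sm: "summable (\<lambda>n. norm (complex_of_real (m (n + k)) * a n))" if "a \<in> H2" for a k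
  proof (rule summable_comparison_test')
    show "summable (\<lambda>n. C * real (Suc k) powr - p * (\<bar>?w n\<bar> * norm (a n)))"
      by (intro summable_mult H2_Cauchy_Schwarz(1) that w)
    show "norm (norm (complex_of_real (m (n + k)) * a n))
        \<le> C * real (Suc k) powr - p * (\<bar>?w n\<bar> * norm (a n))" for n
      using term_le by simp
  qed
  have "(\<Sum>n. norm (complex_of_real (m (n + k)) * a n)) \<le> D * real (Suc k) powr - p * H2_norm a"
    if a: "a \<in> H2" for a k
  proof -
    have CS: "summable (\<lambda>n. \<bar>?w n\<bar> * norm (a n))"
      "(\<Sum>n. \<bar>?w n\<bar> * norm (a n)) \<le> sqrt (\<Sum>n. (?w n)\<^sup>2) * H2_norm a"
      using H2_Cauchy_Schwarz[OF a w] by blast+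
    have "(\<Sum>n. norm (complex_of_real (m (n + k)) * a n))
        \<le> (\<Sum>n. C * real (Suc k) powr - p * (\<bar>?w n\<bar> * norm (a n)))"
      by (intro suminf_le term_le sm a summable_mult CS)
    also have "\<dots> = C * real (Suc k) powr - p * (\<Sum>n. \<bar>?w n\<bar> * norm (a n))"
      by (intro suminf_mult CS)
    also have "\<dots> \<le> C * real (Suc k) powr - p * (sqrt (\<Sum>n. (?w n)\<^sup>2) * H2_norm a)"
      using C by (intro mult_left_mono CS) auto
    finally show ?thesis by (simp add: D_def mult_ac)
  qed
  moreover have "D \<ge> 0"
    unfolding D_def using C by (intro mult_nonneg_nonneg real_sqrt_ge_zero suminf_nonneg w) auto
  ultimately show thesis using that sm by blast
qed

lemma norm_partial_sum_H2_le:
  assumes a: "a \<in> H2"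
  shows "norm (\<Sum>n\<le>k. a n) \<le> sqrt (real (Suc k)) * H2_norm a"
proof -
  \<comment> \<open>The weight is the indicator of {0..k}, whose squared l^2 norm is k + 1.\<close>
  let ?w = "\<lambda>n. of_bool (n \<le> k) :: real"
  have sums: "(\<lambda>n. ?w n * f n) sums (\<Sum>n\<le>k. f n)" for f :: "nat \<Rightarrow> real"
    using sums_If_finite_set[of "{..k}" f] by (simp add: of_bool_def if_distrib[where f="\<lambda>x. x * _"] cong: if_cong)
  have w: "(\<lambda>n. (?w n)\<^sup>2) sums real (Suc k)"
    using sums[of "\<lambda>_. 1"] by (simp add: of_bool_def if_distrib[where f="\<lambda>x. x\<^sup>2"] cong: if_cong)
  have "norm (\<Sum>n\<le>k. a n) \<le> (\<Sum>n\<le>k. norm (a n))" by (rule norm_sum)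
  also have "\<dots> = (\<Sum>n. \<bar>?w n\<bar> * norm (a n))"
    using sums[of "\<lambda>n. norm (a n)"] by (simp add: sums_iff)
  also have "\<dots> \<le> sqrt (\<Sum>n. (?w n)\<^sup>2) * H2_norm a"
    using H2_Cauchy_Schwarz(2)[OF a, of ?w] w by (simp add: sums_iff)
  also have "(\<Sum>n. (?w n)\<^sup>2) = real (Suc k)" using w by (rule sums_unique[symmetric])
  finally show ?thesis .
qed

section \<open>Exchange of double series and symmetry of the Hankel form\<close>

lemma suminf_swap:
  fixes F :: "nat \<Rightarrow> nat \<Rightarrow> 'a :: banach"
  assumes row: "\<And>k. summable (\<lambda>n. norm (F k n))" "summable (\<lambda>k. \<Sum>n. norm (F k n))"
    and col: "\<And>n. summable (\<lambda>k. norm (F k n))" "summable (\<lambda>n. \<Sum>k. norm (F k n))"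
  shows "(\<Sum>k. \<Sum>n. F k n) = (\<Sum>n. \<Sum>k. F k n)"
proof -
  have infsum_eq: "infsum f UNIV = suminf f" if "summable (\<lambda>n. norm (f n))"
    for f :: "nat \<Rightarrow> 'b :: banach"
    using norm_summable_imp_has_sum[OF that summable_sums[OF summable_norm_cancel[OF that]]]
    by (rule infsumI)
  have iterated: "(\<Sum>k. \<Sum>n. G k n) = infsum (\<lambda>k. infsum (G k) UNIV) UNIV"
    if G: "\<And>k. summable (\<lambda>n. norm (G k n))" "summable (\<lambda>k. \<Sum>n. norm (G k n))"
    for G :: "nat \<Rightarrow> nat \<Rightarrow> 'a"
  proof -
    have "summable (\<lambda>k. norm (\<Sum>n. G k n))"
      by (rule summable_comparison_test'[OF G(2), of 0]) (simp add: summable_norm G(1))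
    then show ?thesis by (simp add: infsum_eq G(1))
  qed
  \<comment> \<open>Absolute summability over all pairs comes from the rows. The column hypotheses
    serve at the end to identify the other iterated sum with nested \<open>suminf\<close>.\<close>
  have "(\<lambda>x. norm (case x of (k, n) \<Rightarrow> F k n)) summable_on UNIV \<times> UNIV"
  proof (rule Infinite_Sum.abs_summable_on_Sigma_iff[THEN iffD2], intro conjI ballI)
    show "(\<lambda>n. norm (case (k, n) of (k, n) \<Rightarrow> F k n)) summable_on UNIV" for k
      using norm_summable_imp_summable_on[of "\<lambda>n. norm (F k n)"] row(1) by simp
    have "infsum (\<lambda>n. norm (F k n)) UNIV = (\<Sum>n. norm (F k n))" for k
      by (rule infsum_eq) (simp add: row(1))
    then show "(\<lambda>k. norm (\<Sum>\<^sub>\<infinity>n. norm (case (k, n) of (k, n) \<Rightarrow> F k n))) summable_on UNIV"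
      using norm_summable_imp_summable_on[of "\<lambda>k. \<Sum>n. norm (F k n)"] row
      by (simp add: suminf_nonneg)
  qed
  then have "(\<lambda>(k, n). F k n) summable_on UNIV \<times> UNIV"
    by (rule Infinite_Sum.abs_summable_summable)
  from infsum_swap_banach[OF this] show ?thesis
    by (simp add: iterated row col)
qed

text \<open>The kernel is real and symmetric in n and k, so the point is to exchange the two sums.
  The double series converges absolutely because \<open>d\<close> and the second sequence are both
  square summable.\<close>

lemma Hankel_self_adjoint:
  assumes sm: "\<And>a k. a \<in> H2 \<Longrightarrow> summable (\<lambda>n. norm (complex_of_real (moment \<mu> (n + k)) * a n))"
    and bound: "\<And>a k. a \<in> H2 \<Longrightarrow>
       (\<Sum>n. norm (complex_of_real (moment \<mu> (n + k)) * a n)) \<le> d k * H2_norm a"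
    and d: "\<And>k. 0 \<le> d k" "summable (\<lambda>k. (d k)\<^sup>2)"
  shows "self_adjoint_H2 (Hankel \<mu>)"
  unfolding self_adjoint_H2_def
proof (intro ballI)
  fix a b assume a: "a \<in> H2" and b: "b \<in> H2"
  let ?m = "\<lambda>n. complex_of_real (moment \<mu> n)"
  \<comment> \<open>Stated for an arbitrary pair: (a, b') gives the rows of the double series and
    (b', a) its columns.\<close>
  have rows: "summable (\<lambda>n. norm (?m (n + k) * u n * v k))"
    "summable (\<lambda>k. \<Sum>n. norm (?m (n + k) * u n * v k))"
    if u: "u \<in> H2" and v: "v \<in> H2" for u v :: cseq and k
  proof -
    have eq: "norm (?m (n + k) * u n * v k) = norm (?m (n + k) * u n) * norm (v k)" for n k
      by (rule norm_mult)
    show "summable (\<lambda>n. norm (?m (n + k) * u n * v k))"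
      unfolding eq by (intro summable_mult2 sm u)
    show "summable (\<lambda>k. \<Sum>n. norm (?m (n + k) * u n * v k))"
    proof (rule summable_comparison_test')
      show "summable (\<lambda>k. H2_norm u * (\<bar>d k\<bar> * norm (v k)))"
        by (intro summable_mult H2_Cauchy_Schwarz v d)
      fix k
      have "(\<Sum>n. norm (?m (n + k) * u n * v k)) = (\<Sum>n. norm (?m (n + k) * u n)) * norm (v k)"
        unfolding eq by (intro suminf_mult2[symmetric] sm u)
      also have "\<dots> \<le> d k * H2_norm u * norm (v k)"
        by (intro mult_right_mono bound u) simp
      finally show "norm (\<Sum>n. norm (?m (n + k) * u n * v k)) \<le> H2_norm u * (\<bar>d k\<bar> * norm (v k))"
        using suminf_nonneg[OF summable_mult2[OF sm[OF u, of k], of "norm (v k)"]] d(1)[of k]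
        unfolding eq by (simp add: mult_ac)
    qed
  qed
  define b' where "b' = (\<lambda>n. cnj (b n))"
  have b': "b' \<in> H2" using b by (simp add: b'_def H2_def)
  have "H2_inner (Hankel \<mu> a) b = (\<Sum>k. \<Sum>n. ?m (n + k) * a n * b' k)"
    unfolding H2_inner_def Hankel_def b'_def
    by (intro suminf_cong suminf_mult2 summable_norm_cancel[OF sm] a)
  also have "\<dots> = (\<Sum>n. \<Sum>k. ?m (n + k) * a n * b' k)"
  proof (rule suminf_swap)
    have eq: "norm (?m (n + k) * a n * b' k) = norm (?m (k + n) * b' k * a n)" for n k
      by (simp add: add.commute mult_ac)
    show "summable (\<lambda>k. norm (?m (n + k) * a n * b' k))" for n
      unfolding eq by (rule rows(1)[OF b' a])
    show "summable (\<lambda>n. \<Sum>k. norm (?m (n + k) * a n * b' k))"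
      unfolding eq by (rule rows(2)[OF b' a])
  qed (rule rows[OF a b'])+
  also have "\<dots> = (\<Sum>n. a n * (\<Sum>k. ?m (k + n) * b' k))"
    by (subst suminf_mult[symmetric, OF summable_norm_cancel[OF sm[OF b']]])
       (simp add: mult_ac add.commute)
  also have "\<dots> = H2_inner a (Hankel \<mu> b)"
  proof -
    have "(\<Sum>k. ?m (k + n) * b' k) = cnj (\<Sum>k. ?m (k + n) * b k)" for n
      using sums_cnj[THEN iffD2, OF summable_sums[OF summable_norm_cancel[OF sm[OF b, of n]]]]
      by (simp add: b'_def sums_iff)
    then show ?thesis by (simp add: H2_inner_def Hankel_def)
  qed
  finally show "H2_inner (Hankel \<mu> a) b = H2_inner a (Hankel \<mu> b)" .
qed

subsection \<open>Bounded holomorphic functions\<close>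

text \<open>Consecutive partial sums differ by \<open>a n\<close>. The logarithm is weaker than
  Cauchy's estimate but still gives absolute convergence against moments of order n^(-r) with r >
  1.\<close>

lemma norm_coeff_Hinf_le:
  assumes a: "a \<in> Hinf"
  shows "norm (a n) \<le> 2 * (1 + ln (real (Suc n))) * Hinf_norm a"
proof (cases n)
  case 0
  then show ?thesis
    using norm_partial_sum_Hinf_le[OF a, of 0] Hinf_norm_nonneg[OF a] by simp
next
  case (Suc m)
  have "a n = (\<Sum>i\<le>n. a i) - (\<Sum>i\<le>m. a i)" by (simp add: Suc)
  then have "norm (a n) \<le> norm (\<Sum>i\<le>n. a i) + norm (\<Sum>i\<le>m. a i)"
    by (metis norm_triangle_ineq4)
  also have "norm (\<Sum>i\<le>n. a i) \<le> (1 + ln (real (Suc n))) * Hinf_norm a"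
    by (rule norm_partial_sum_Hinf_le[OF a])
  also have "norm (\<Sum>i\<le>m. a i) \<le> (1 + ln (real (Suc m))) * Hinf_norm a"
    by (rule norm_partial_sum_Hinf_le[OF a])
  also have "\<dots> \<le> (1 + ln (real (Suc n))) * Hinf_norm a"
    using Hinf_norm_nonneg[OF a] by (intro mult_right_mono) (auto simp: Suc)
  finally show ?thesis by (simp add: algebra_simps)
qed

text \<open>Summing under the integral turns the coordinate into the integral of t^k f(t), where f
  is bounded by its sup norm. Hypothesis \<open>abs\<close> says that the L^1 norms of the terms are
  summable, which justifies the exchange.\<close>

lemma Hankel_Hinf_bound:
  assumes \<mu>: "measure_on_01 \<mu>" and a: "a \<in> Hinf"
    and abs: "summable (\<lambda>n. norm (complex_of_real (moment \<mu> (n + k)) * a n))"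
  shows "norm (Hankel \<mu> a k) \<le> moment \<mu> k * Hinf_norm a"
proof -
  have [measurable_cong]: "sets \<mu> = sets borel" using \<mu> by (simp add: measure_on_01_def)
  let ?f = "\<lambda>n t. complex_of_real (t ^ (n + k)) * a n"
  have int: "integrable \<mu> (?f n)" for n
    by (intro integrable_mult_left integrable_of_real integrable_power_01 \<mu>)
  have int_f: "(\<integral>t. ?f n t \<partial>\<mu>) = complex_of_real (moment \<mu> (n + k)) * a n" for n
    by (simp add: moment_def integrable_power_01 \<mu> flip: of_real_power)
  have int_norm: "(\<integral>t. norm (?f n t) \<partial>\<mu>) = norm (complex_of_real (moment \<mu> (n + k)) * a n)" for n
  proof -
    have "(\<integral>t. norm (?f n t) \<partial>\<mu>) = (\<integral>t. t ^ (n + k) * norm (a n) \<partial>\<mu>)"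
    proof (rule integral_cong_AE)
      show "AE t in \<mu>. norm (?f n t) = t ^ (n + k) * norm (a n)"
        using AE_in_01[OF \<mu>] by eventually_elim (simp add: norm_mult norm_power)
    qed measurable
    then show ?thesis
      using moment_nonneg[OF \<mu>, of "n + k"] by (simp add: norm_mult moment_def)
  qed
  have f_sums: "(\<Sum>n. ?f n t) = complex_of_real t ^ k * (\<Sum>n. a n * complex_of_real t ^ n)"
    "summable (\<lambda>n. norm (?f n t))"
    if t: "0 \<le> t \<and> t < 1" for t
  proof -
    obtain s where s: "t < s" "s < 1" using dense t by blast
    have "summable (\<lambda>n. a n * complex_of_real s ^ n)" using a s t by (simp add: Hinf_def)
    then have abs_t: "summable (\<lambda>n. norm (a n * complex_of_real t ^ n))"
      by (rule powser_insidea) (use s t in simp)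
    have eq: "?f n t = complex_of_real t ^ k * (a n * complex_of_real t ^ n)" for n
      by (simp add: power_add mult_ac)
    show "(\<Sum>n. ?f n t) = complex_of_real t ^ k * (\<Sum>n. a n * complex_of_real t ^ n)"
      unfolding eq by (intro suminf_mult summable_norm_cancel[OF abs_t])
    show "summable (\<lambda>n. norm (?f n t))"
      unfolding eq norm_mult[of "_ ^ k"] by (intro summable_mult abs_t)
  qed
  have AE_sm: "AE t in \<mu>. summable (\<lambda>n. norm (?f n t))"
    using AE_in_01[OF \<mu>] by eventually_elim (rule f_sums(2))
  have sm: "summable (\<lambda>n. \<integral>t. norm (?f n t) \<partial>\<mu>)" using abs by (simp only: int_norm)
  have "Hankel \<mu> a k = (\<integral>t. (\<Sum>n. ?f n t) \<partial>\<mu>)"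
    unfolding integral_suminf[OF int AE_sm sm] int_f Hankel_def ..
  also have "norm \<dots> \<le> (\<integral>t. norm (\<Sum>n. ?f n t) \<partial>\<mu>)"
    by (rule integral_norm_bound)
  also have "\<dots> \<le> (\<integral>t. t ^ k * Hinf_norm a \<partial>\<mu>)"
  proof (rule integral_mono_AE)
    show "integrable \<mu> (\<lambda>t. norm (\<Sum>n. ?f n t))"
      by (intro integrable_norm integrable_suminf[OF int AE_sm sm])
    show "integrable \<mu> (\<lambda>t. t ^ k * Hinf_norm a)"
      by (intro integrable_mult_left integrable_power_01 \<mu>)
    show "AE t in \<mu>. norm (\<Sum>n. ?f n t) \<le> t ^ k * Hinf_norm a"
      using AE_in_01[OF \<mu>]
    proof eventually_elim
      case (elim t)
      then show ?case
        unfolding f_sums(1)[OF elim] norm_mult norm_power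
        by (intro mult_mono norm_le_Hinf_norm a) auto
    qed
  qed
  also have "\<dots> = moment \<mu> k * Hinf_norm a" by (simp add: moment_def)
  finally show ?thesis .
qed

section \<open>Linearity and nuclearity criteria for both operators\<close>

lemma Hankel_add:
  assumes "\<And>a k. a \<in> X \<Longrightarrow> summable (\<lambda>n. complex_of_real (moment \<mu> (n + k)) * a n)"
    and "a \<in> X" "b \<in> X"
  shows "Hankel \<mu> (\<lambda>i. a i + b i) k = Hankel \<mu> a k + Hankel \<mu> b k"
  using suminf_add[OF assms(1)[OF assms(2), of k] assms(1)[OF assms(3), of k]]
  by (simp add: Hankel_def distrib_left)

lemma Hankel_scale:
  assumes "\<And>a k. a \<in> X \<Longrightarrow> summable (\<lambda>n. complex_of_real (moment \<mu> (n + k)) * a n)"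
    and "a \<in> X"
  shows "Hankel \<mu> (\<lambda>i. s * a i) k = s * Hankel \<mu> a k"
  using suminf_mult[OF assms(1)[OF assms(2), of k], of s]
  by (simp add: Hankel_def mult_ac)

lemma Cesaro_add: "Cesaro \<mu> (\<lambda>i. a i + b i) k = Cesaro \<mu> a k + Cesaro \<mu> b k"
  by (simp add: Cesaro_def sum.distrib distrib_left)

lemma Cesaro_scale: "Cesaro \<mu> (\<lambda>i. s * a i) k = s * Cesaro \<mu> a k"
  by (simp add: Cesaro_def sum_distrib_left mult.left_commute)

lemma Hankel_nuclear_AT:
  assumes sm: "\<And>a k. a \<in> X \<Longrightarrow> summable (\<lambda>n. complex_of_real (moment \<mu> (n + k)) * a n)"
    and bound: "\<And>a k. a \<in> X \<Longrightarrow> norm (Hankel \<mu> a k) \<le> d k * nX a"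
    and d: "\<And>k. 0 \<le> d k" "summable d"
  shows "Hankel_well_defined \<mu> X AT" "nuclear_op X nX AT AT_norm (Hankel \<mu>)"
proof -
  show "Hankel_well_defined \<mu> X AT"
    unfolding Hankel_well_defined_def using sm AT_of_coordinate_bound[OF bound d(2)] by blast
  show "nuclear_op X nX AT AT_norm (Hankel \<mu>)"
  proof (rule nuclear_op_AT_of_coordinate_bounds)
    show "Hankel \<mu> (\<lambda>i. a i + b i) k = Hankel \<mu> a k + Hankel \<mu> b k"
      if "a \<in> X" "b \<in> X" for a b k
      using sm that by (rule Hankel_add)
    show "Hankel \<mu> (\<lambda>i. s * a i) k = s * Hankel \<mu> a k" if "a \<in> X" for a s k
      using sm that by (rule Hankel_scale)
  qed (fact bound d)+
qed

lemma Cesaro_nuclear_AT: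
  assumes bound: "\<And>a k. a \<in> X \<Longrightarrow> norm (Cesaro \<mu> a k) \<le> d k * nX a"
    and d: "\<And>k. 0 \<le> d k" "summable d"
  shows "Cesaro_well_defined \<mu> X AT" "nuclear_op X nX AT AT_norm (Cesaro \<mu>)"
proof -
  show "Cesaro_well_defined \<mu> X AT"
    unfolding Cesaro_well_defined_def using AT_of_coordinate_bound[OF bound d(2)] by blast
  show "nuclear_op X nX AT AT_norm (Cesaro \<mu>)"
    by (rule nuclear_op_AT_of_coordinate_bounds[OF _ _ bound d]) (simp_all add: Cesaro_add Cesaro_scale)
qed

lemma Hankel_Cesaro_nuclear_Hinf_AT:
  assumes \<mu>: "measure_on_01 \<mu>" and r: "r > 1" and "r_Carleson r \<mu>"
  shows "Hankel_well_defined \<mu> Hinf AT" "nuclear_op Hinf Hinf_norm AT AT_norm (Hankel \<mu>)"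
    and "Cesaro_well_defined \<mu> Hinf AT" "nuclear_op Hinf Hinf_norm AT AT_norm (Cesaro \<mu>)"
proof -
  obtain C where C: "C \<ge> 0" and moment: "\<And>n. moment \<mu> n \<le> C * real (Suc n) powr - r"
    using moment_le_powr[OF \<mu> _ assms(3)] r by auto
  let ?L = "\<lambda>n. 1 + ln (real (Suc n))"
  have L: "?L n \<ge> 0" for n using ln_ge_zero[of "real (Suc n)"] by linarith
  have moment_nn: "0 \<le> moment \<mu> n" for n by (rule moment_nonneg[OF \<mu>])
  have abs: "summable (\<lambda>n. norm (complex_of_real (moment \<mu> (n + k)) * a n))"
    if a: "a \<in> Hinf" for a k
  proof (rule summable_comparison_test')
    show "summable (\<lambda>n. (C * 2 * Hinf_norm a) * (real (Suc n) powr - r * ?L n))"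
      by (intro summable_mult summable_Suc_powr_log r)
    fix n
    \<comment> \<open>The power bound decreases in k, so dropping k leaves a majorant valid for
      every row.\<close>
    have "moment \<mu> (n + k) \<le> C * real (Suc n) powr - r"
    proof (rule order_trans[OF moment])
      show "C * real (Suc (n + k)) powr - r \<le> C * real (Suc n) powr - r"
        using C r by (intro mult_left_mono powr_mono2') auto
    qed
    then have "moment \<mu> (n + k) * norm (a n) \<le> (C * real (Suc n) powr - r) * (2 * ?L n * Hinf_norm a)"
      using moment_nn[of "n + k"] by (intro mult_mono' norm_coeff_Hinf_le a) auto
    then show "norm (norm (complex_of_real (moment \<mu> (n + k)) * a n))
        \<le> (C * 2 * Hinf_norm a) * (real (Suc n) powr - r * ?L n)"
      using moment_nn[of "n + k"] by (simp add: norm_mult algebra_simps)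
  qed
  have summable_moment: "summable (moment \<mu>)"
    by (rule summable_comparison_test'[of "\<lambda>n. C * real (Suc n) powr - r" 0])
       (use r moment moment_nn in \<open>auto simp: summable_Suc_powr_iff simp del: of_nat_Suc intro!: summable_mult\<close>)
  show "Hankel_well_defined \<mu> Hinf AT" "nuclear_op Hinf Hinf_norm AT AT_norm (Hankel \<mu>)"
    using Hankel_nuclear_AT[OF summable_norm_cancel[OF abs] Hankel_Hinf_bound[OF \<mu> _ abs]
        moment_nn summable_moment] by auto
  have "norm (Cesaro \<mu> a k) \<le> (moment \<mu> k * ?L k) * Hinf_norm a" if a: "a \<in> Hinf" for a k
    using mult_left_mono[OF norm_partial_sum_Hinf_le[OF a, of k] moment_nn[of k]] moment_nn[of k]
    by (simp add: Cesaro_def norm_mult mult.assoc)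
  moreover have "summable (\<lambda>k. moment \<mu> k * ?L k)"
  proof (rule summable_comparison_test')
    show "summable (\<lambda>n. C * (real (Suc n) powr - r * ?L n))"
      by (intro summable_mult summable_Suc_powr_log r)
    show "norm (moment \<mu> n * ?L n) \<le> C * (real (Suc n) powr - r * ?L n)" for n
      using mult_right_mono[OF moment[of n] L[of n]] moment_nn[of n] L[of n]
      by (simp add: abs_mult mult.assoc)
  qed
  moreover have "0 \<le> moment \<mu> k * ?L k" for k using moment_nn[of k] L[of k] by (rule mult_nonneg_nonneg)
  ultimately show "Cesaro_well_defined \<mu> Hinf AT" "nuclear_op Hinf Hinf_norm AT AT_norm (Cesaro \<mu>)"
    using Cesaro_nuclear_AT[of Hinf \<mu> "\<lambda>k. moment \<mu> k * ?L k" Hinf_norm] by auto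
qed

subsection \<open>The Hankel and Cesaro operators on \<open>H\<^sup>2\<close>\<close>

text \<open>One constant and one exponent serve both operators: p > 1/2 makes the bounds square
  summable, for compactness, and p > 1 makes them summable, for nuclearity.\<close>

lemma H2_coordinate_bounds:
  assumes \<mu>: "measure_on_01 \<mu>" and "r_Carleson r \<mu>" and p: "0 \<le> p" "p < r - 1 / 2"
  shows "\<exists>D\<ge>0. \<forall>a\<in>H2. \<forall>k.
     summable (\<lambda>n. norm (complex_of_real (moment \<mu> (n + k)) * a n)) \<and>
     (\<Sum>n. norm (complex_of_real (moment \<mu> (n + k)) * a n)) \<le> D * real (Suc k) powr - p * H2_norm a \<and>
     norm (Hankel \<mu> a k) \<le> D * real (Suc k) powr - p * H2_norm a \<and>
     norm (Cesaro \<mu> a k) \<le> D * real (Suc k) powr - p * H2_norm a"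
proof -
  obtain C where C: "C \<ge> 0" and moment: "\<And>n. moment \<mu> n \<le> C * real (Suc n) powr - r"
    using moment_le_powr[OF \<mu> _ assms(2)] p by auto
  have moment_nn: "0 \<le> moment \<mu> n" for n by (rule moment_nonneg[OF \<mu>])
  obtain D where D: "D \<ge> 0"
    and sm: "\<And>a k. a \<in> H2 \<Longrightarrow> summable (\<lambda>n. norm (complex_of_real (moment \<mu> (n + k)) * a n))"
    and row: "\<And>a k. a \<in> H2 \<Longrightarrow>
       (\<Sum>n. norm (complex_of_real (moment \<mu> (n + k)) * a n)) \<le> D * real (Suc k) powr - p * H2_norm a"
    using Hankel_row_H2_bound[OF moment_nn moment C p] by blast
  let ?d = "\<lambda>k. (C + D) * real (Suc k) powr - p"
  have row_d: "(\<Sum>n. norm (complex_of_real (moment \<mu> (n + k)) * a n)) \<le> ?d k * H2_norm a"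
    if a: "a \<in> H2" for a k
  proof -
    have "D * real (Suc k) powr - p * H2_norm a \<le> ?d k * H2_norm a"
      using C H2_norm_nonneg[OF a] by (intro mult_right_mono) auto
    then show ?thesis using row[OF a, of k] by linarith
  qed
  have Hankel: "norm (Hankel \<mu> a k) \<le> ?d k * H2_norm a" if a: "a \<in> H2" for a k
    unfolding Hankel_def using summable_norm[OF sm[OF a]] row_d[OF a] by (rule order_trans)
  have Cesaro: "norm (Cesaro \<mu> a k) \<le> ?d k * H2_norm a" if a: "a \<in> H2" for a k
  proof -
    have "norm (Cesaro \<mu> a k) = moment \<mu> k * norm (\<Sum>n\<le>k. a n)"
      using moment_nn[of k] by (simp add: Cesaro_def norm_mult)
    also have "\<dots> \<le> (C * real (Suc k) powr - r) * (sqrt (real (Suc k)) * H2_norm a)"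
      using moment_nn by (intro mult_mono' moment norm_partial_sum_H2_le a) auto
    also have "\<dots> = C * (real (Suc k) powr - r * real (Suc k) powr (1 / 2)) * H2_norm a"
      by (simp add: powr_half_sqrt)
    also have "real (Suc k) powr - r * real (Suc k) powr (1 / 2) = real (Suc k) powr (1 / 2 - r)"
      by (simp only: powr_add[symmetric] uminus_add_conv_diff)
    \<comment> \<open>Here 1/2 - r < -p and the base is at least 1.\<close>
    also have "C * real (Suc k) powr (1 / 2 - r) * H2_norm a \<le> ?d k * H2_norm a"
      using C D p H2_norm_nonneg[OF a]
      by (intro mult_right_mono mult_mono powr_mono) auto
    finally show ?thesis .
  qed
  show ?thesis
    using C D by (intro exI[of _ "C + D"] conjI ballI allI sm row_d Hankel Cesaro) auto
qed

theorem theorem33: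
  fixes \<mu> :: "real measure" and r :: real
  assumes "measure_on_01 \<mu>" and "r > 1" and "r_Carleson r \<mu>"
  shows "(Hankel_well_defined \<mu> Hinf AT \<and> nuclear_op Hinf Hinf_norm AT AT_norm (Hankel \<mu>) \<and>
          Cesaro_well_defined \<mu> Hinf AT \<and> nuclear_op Hinf Hinf_norm AT AT_norm (Cesaro \<mu>))
       \<and> (Hankel_well_defined \<mu> H2 H2 \<and> compact_op H2 H2_norm H2 H2_norm (Hankel \<mu>) \<and>
          Cesaro_well_defined \<mu> H2 H2 \<and> compact_op H2 H2_norm H2 H2_norm (Cesaro \<mu>) \<and>
          self_adjoint_H2 (Hankel \<mu>))
       \<and> (r > 3/2 \<longrightarrow>
          (Hankel_well_defined \<mu> H2 AT \<and> nuclear_op H2 H2_norm AT AT_norm (Hankel \<mu>) \<and>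
           Cesaro_well_defined \<mu> H2 AT \<and> nuclear_op H2 H2_norm AT AT_norm (Cesaro \<mu>)))"
proof (intro conjI[where P="_ \<and> _"] impI)
  show "Hankel_well_defined \<mu> Hinf AT \<and> nuclear_op Hinf Hinf_norm AT AT_norm (Hankel \<mu>) \<and>
      Cesaro_well_defined \<mu> Hinf AT \<and> nuclear_op Hinf Hinf_norm AT AT_norm (Cesaro \<mu>)"
    using Hankel_Cesaro_nuclear_Hinf_AT[OF assms] by blast
next
  \<comment> \<open>The midpoint of 1/2 and r - 1/2, an interval that is nonempty because r >
    1.\<close>
  define p where "p = r / 2"
  have p: "0 \<le> p" "p < r - 1 / 2" "p > 1 / 2" using assms(2) by (auto simp: p_def)
  obtain D where D: "D \<ge> 0" and bounds: "\<forall>a\<in>H2. \<forall>k.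
     summable (\<lambda>n. norm (complex_of_real (moment \<mu> (n + k)) * a n)) \<and>
     (\<Sum>n. norm (complex_of_real (moment \<mu> (n + k)) * a n)) \<le> D * real (Suc k) powr - p * H2_norm a \<and>
     norm (Hankel \<mu> a k) \<le> D * real (Suc k) powr - p * H2_norm a \<and>
     norm (Cesaro \<mu> a k) \<le> D * real (Suc k) powr - p * H2_norm a"
    using H2_coordinate_bounds[OF assms(1,3) p(1,2)] by blast
  define d where "d = (\<lambda>k. D * real (Suc k) powr - p)"
  have d: "0 \<le> d k" "summable (\<lambda>k. (d k)\<^sup>2)" for k
    using D unfolding d_def power_mult_distrib
    by (auto intro!: summable_mult summable_Suc_powr_sq p(3) simp del: of_nat_Suc)
  have sm: "summable (\<lambda>n. norm (complex_of_real (moment \<mu> (n + k)) * a n))"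
    and row: "(\<Sum>n. norm (complex_of_real (moment \<mu> (n + k)) * a n)) \<le> d k * H2_norm a"
    and H: "norm (Hankel \<mu> a k) \<le> d k * H2_norm a"
    and C: "norm (Cesaro \<mu> a k) \<le> d k * H2_norm a" if "a \<in> H2" for a k
    using bounds that unfolding d_def by blast+
  show "Hankel_well_defined \<mu> H2 H2 \<and> compact_op H2 H2_norm H2 H2_norm (Hankel \<mu>) \<and>
      Cesaro_well_defined \<mu> H2 H2 \<and> compact_op H2 H2_norm H2 H2_norm (Cesaro \<mu>) \<and>
      self_adjoint_H2 (Hankel \<mu>)"
    unfolding Hankel_well_defined_def Cesaro_well_defined_def
    by (intro conjI ballI allI summable_norm_cancel[OF sm]
        H2_of_coordinate_bound[OF H d(2)] H2_of_coordinate_bound[OF C d(2)]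
        compact_op_H2_of_coordinate_bounds[OF H d] compact_op_H2_of_coordinate_bounds[OF C d]
        Hankel_self_adjoint[OF sm row d])
next
  assume r: "r > 3 / 2"
  \<comment> \<open>The midpoint of 1 and r - 1/2. Here r > 3/2 is what leaves room above 1.\<close>
  define p where "p = (r + 1 / 2) / 2"
  have p: "0 \<le> p" "p < r - 1 / 2" "p > 1"
    using r by (auto simp: p_def field_simps)
  obtain D where D: "D \<ge> 0" and bounds: "\<forall>a\<in>H2. \<forall>k.
     summable (\<lambda>n. norm (complex_of_real (moment \<mu> (n + k)) * a n)) \<and>
     (\<Sum>n. norm (complex_of_real (moment \<mu> (n + k)) * a n)) \<le> D * real (Suc k) powr - p * H2_norm a \<and>
     norm (Hankel \<mu> a k) \<le> D * real (Suc k) powr - p * H2_norm a \<and>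
     norm (Cesaro \<mu> a k) \<le> D * real (Suc k) powr - p * H2_norm a"
    using H2_coordinate_bounds[OF assms(1,3) p(1,2)] by blast
  define d where "d = (\<lambda>k. D * real (Suc k) powr - p)"
  have d: "0 \<le> d k" "summable d" for k
    using D p(3) unfolding d_def
    by (auto intro!: summable_mult simp: summable_Suc_powr_iff simp del: of_nat_Suc)
  have sm: "summable (\<lambda>n. norm (complex_of_real (moment \<mu> (n + k)) * a n))"
    and H: "norm (Hankel \<mu> a k) \<le> d k * H2_norm a"
    and C: "norm (Cesaro \<mu> a k) \<le> d k * H2_norm a" if "a \<in> H2" for a k
    using bounds that unfolding d_def by blast+
  show "Hankel_well_defined \<mu> H2 AT \<and> nuclear_op H2 H2_norm AT AT_norm (Hankel \<mu>) \<and>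
      Cesaro_well_defined \<mu> H2 AT \<and> nuclear_op H2 H2_norm AT AT_norm (Cesaro \<mu>)"
    by (intro conjI Hankel_nuclear_AT[OF summable_norm_cancel[OF sm] H d] Cesaro_nuclear_AT[OF C d])
qed

end
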